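(* Let $z:\mathbb{Z}^3\to\mathbb{C}$, $(l_1,l_2,l_3)\mapsto z_{l_1,l_2,l_3}$, satisfy the discrete Schwarzian KP equation $$\frac{(z_{l_1+1,l_2,l_3}-z_{l_1+1,l_2+1,l_3})(z_{l_1,l_2+1,l_3}-z_{l_1,l_2+1,l_3+1})(z_{l_1,l_2,l_3+1}-z_{l_1+1,l_2,l_3+1})}{(z_{l_1+1,l_2+1,l_3}-z_{l_1,l_2+1,l_3})(z_{l_1,l_2+1,l_3+1}-z_{l_1,l_2,l_3+1})(z_{l_1+1,l_2,l_3+1}-z_{l_1+1,l_2,l_3})}=-1$$ for all $(l_1,l_2,l_3)\in\mathbb{Z}^3$, together with the two conditions $$\frac{(z_{l_1+1,l_2,l_3}-z_{l_1+1,l_2+1,l_3})(z_{l_1,l_2+1,l_3}-z_{l_1,l_2+1,l_3-1})(z_{l_1,l_2,l_3-1}-z_{l_1+1,l_2,l_3-1})}{(z_{l_1+1,l_2+1,l_3}-z_{l_1,l_2+1,l_3})(z_{l_1,l_2+1,l_3-1}-z_{l_1,l_2,l_3-1})(z_{l_1+1,l_2,l_3-1}-z_{l_1+1,l_2,l_3})}=-1,$$ $$\frac{(z_{l_1+1,l_2,l_3}-z_{l_1+1,l_2-1,l_3})(z_{l_1,l_2-1,l_3}-z_{l_1,l_2-1,l_3+1})(z_{l_1,l_2,l_3+1}-z_{l_1+1,l_2,l_3+1})}{(z_{l_1+1,l_2-1,l_3}-z_{l_1,l_2-1,l_3})(z_{l_1,l_2-1,l_3+1}-z_{l_1,l_2,l_3+1})(z_{l_1+1,l_2,l_3+1}-z_{l_1+1,l_2,l_3})}=-1$$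 for all $(l_1,l_2,l_3)\in\mathbb{Z}^3$. Then the equation reduces to the discrete Schwarzian KdV equation: for each fixed $l_3$, writing $z_{l_1,l_2}=z_{l_1,l_2,l_3}$, there exist functions $\lambda$ of $l_1$ alone and $\mu$ of $l_2$ alone such that $$\frac{(z_{l_1,l_2}-z_{l_1+1,l_2})(z_{l_1+1,l_2+1}-z_{l_1,l_2+1})}{(z_{l_1+1,l_2}-z_{l_1+1,l_2+1})(z_{l_1,l_2+1}-z_{l_1,l_2})}=\frac{\lambda(l_1)}{\mu(l_2)}\qquad\text{for all }(l_1,l_2)\in\mathbb{Z}^2 .$$
   Context: All fractions in the hypotheses are assumed to be well defined (nonzero denominators) at every lattice point. *)

theory Defs
  imports Complex_Main
begin

text \<open>
  Division is total in HOL (\<open>x / 0 = 0\<close>), so in both lattice equations below the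
  requirement that the fractions are well defined is stated explicitly.
\<close>

definition discrete_schwarzian_KP :: "(int \<Rightarrow> int \<Rightarrow> int \<Rightarrow> complex) \<Rightarrow> bool" where
  "discrete_schwarzian_KP z \<longleftrightarrow>
    (\<forall>l1 l2 l3.
      (z (l1+1) (l2+1) l3 - z l1 (l2+1) l3) * (z l1 (l2+1) (l3+1) - z l1 l2 (l3+1))
        * (z (l1+1) l2 (l3+1) - z (l1+1) l2 l3) \<noteq> 0 \<and>
      ((z (l1+1) l2 l3 - z (l1+1) (l2+1) l3) * (z l1 (l2+1) l3 - z l1 (l2+1) (l3+1))
        * (z l1 l2 (l3+1) - z (l1+1) l2 (l3+1)))
      / ((z (l1+1) (l2+1) l3 - z l1 (l2+1) l3) * (z l1 (l2+1) (l3+1) - z l1 l2 (l3+1))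
        * (z (l1+1) l2 (l3+1) - z (l1+1) l2 l3)) = -1)"

definition discrete_schwarzian_KdV ::
  "(int \<Rightarrow> complex) \<Rightarrow> (int \<Rightarrow> complex) \<Rightarrow> (int \<Rightarrow> int \<Rightarrow> complex) \<Rightarrow> bool" where
  "discrete_schwarzian_KdV lam mu w \<longleftrightarrow>
    (\<forall>l1 l2.
      (w (l1+1) l2 - w (l1+1) (l2+1)) * (w l1 (l2+1) - w l1 l2) \<noteq> 0 \<and> mu l2 \<noteq> 0 \<and>
      ((w l1 l2 - w (l1+1) l2) * (w (l1+1) (l2+1) - w l1 (l2+1)))
      / ((w (l1+1) l2 - w (l1+1) (l2+1)) * (w l1 (l2+1) - w l1 l2)) = lam l1 / mu l2)"

end

theory Submission
  imports Defs
begin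

text \<open>
  Write \<open>a\<close>, \<open>b\<close>, \<open>c\<close> for the differences of \<open>z\<close> along the edges in the directions
  1, 2, 3. On one elementary cube the KP equation and suitable shifts of the two conditions
  become three monomial identities between edges, all of which are nonzero. The face
  ratios \<open>Q\<^sub>1\<^sub>2 = a a\<^sub>2 / (b b\<^sub>1)\<close>, \<open>Q\<^sub>1\<^sub>3 = a a\<^sub>3 / (c c\<^sub>1)\<close> and \<open>Q\<^sub>2\<^sub>3 = b b\<^sub>3 / (c c\<^sub>2)\<close> (subscripts
  denote shifts) then satisfy \<open>Q\<^sub>1\<^sub>2 = Q\<^sub>1\<^sub>3 / Q\<^sub>2\<^sub>3\<close>, which is the KP equation, while \<open>Q\<^sub>1\<^sub>3\<close> does not
  change under shifts of \<open>l\<^sub>2\<close> and \<open>Q\<^sub>2\<^sub>3\<close> does not change under shifts of \<open>l\<^sub>1\<close>.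
\<close>

lemma int_shift_invariant_const:
  fixes f :: "int \<Rightarrow> 'a"
  assumes "\<And>n. f (n + 1) = f n"
  shows "f n = f 0"
proof (induction n rule: int_induct [where k = 0])
  case (step2 i)
  then show ?case using assms [of "i - 1"] by simp
qed (simp_all add: assms)

theorem proposition2p5:
  fixes z :: "int \<Rightarrow> int \<Rightarrow> int \<Rightarrow> complex"
  assumes KP: "discrete_schwarzian_KP z"
    and den3: "\<And>l1 l2 l3.
      (z (l1+1) (l2+1) l3 - z l1 (l2+1) l3) * (z l1 (l2+1) (l3-1) - z l1 l2 (l3-1))
        * (z (l1+1) l2 (l3-1) - z (l1+1) l2 l3) \<noteq> 0"
    and cond3: "\<And>l1 l2 l3.
      ((z (l1+1) l2 l3 - z (l1+1) (l2+1) l3) * (z l1 (l2+1) l3 - z l1 (l2+1) (l3-1))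
        * (z l1 l2 (l3-1) - z (l1+1) l2 (l3-1)))
      / ((z (l1+1) (l2+1) l3 - z l1 (l2+1) l3) * (z l1 (l2+1) (l3-1) - z l1 l2 (l3-1))
        * (z (l1+1) l2 (l3-1) - z (l1+1) l2 l3)) = -1"
    and den2: "\<And>l1 l2 l3.
      (z (l1+1) (l2-1) l3 - z l1 (l2-1) l3) * (z l1 (l2-1) (l3+1) - z l1 l2 (l3+1))
        * (z (l1+1) l2 (l3+1) - z (l1+1) l2 l3) \<noteq> 0"
    and cond2: "\<And>l1 l2 l3.
      ((z (l1+1) l2 l3 - z (l1+1) (l2-1) l3) * (z l1 (l2-1) l3 - z l1 (l2-1) (l3+1))
        * (z l1 l2 (l3+1) - z (l1+1) l2 (l3+1)))
      / ((z (l1+1) (l2-1) l3 - z l1 (l2-1) l3) * (z l1 (l2-1) (l3+1) - z l1 l2 (l3+1))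
        * (z (l1+1) l2 (l3+1) - z (l1+1) l2 l3)) = -1"
  shows "\<forall>l3. \<exists>lam mu. discrete_schwarzian_KdV lam mu (\<lambda>l1 l2. z l1 l2 l3)"
proof
  fix l3 :: int
  define a where "a l1 l2 l3 = z (l1+1) l2 l3 - z l1 l2 l3" for l1 l2 l3
  define b where "b l1 l2 l3 = z l1 (l2+1) l3 - z l1 l2 l3" for l1 l2 l3
  define c where "c l1 l2 l3 = z l1 l2 (l3+1) - z l1 l2 l3" for l1 l2 l3
  note edges = a_def b_def c_def
  have KP_den: "(z (l1+1) (l2+1) l3 - z l1 (l2+1) l3) * (z l1 (l2+1) (l3+1) - z l1 l2 (l3+1))
      * (z (l1+1) l2 (l3+1) - z (l1+1) l2 l3) \<noteq> 0" for l1 l2 l3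
    using KP unfolding discrete_schwarzian_KP_def by blast
  \<comment> \<open>Each factor of the KP denominator is an edge in one direction; a unit backward
    shift makes it start at an arbitrary lattice point.\<close>
  have a0: "a l1 l2 l3 \<noteq> 0" for l1 l2 l3
    using KP_den [of l1 "l2 - 1" l3] by (simp add: a_def)
  have b0: "b l1 l2 l3 \<noteq> 0" for l1 l2 l3
    using KP_den [of l1 l2 "l3 - 1"] by (simp add: b_def)
  have c0: "c l1 l2 l3 \<noteq> 0" for l1 l2 l3
    using KP_den [of "l1 - 1" l2 l3] by (simp add: c_def)
  note nz = a0 b0 c0
  have eqKP: "b (l1+1) l2 l3 * c l1 (l2+1) l3 * a l1 l2 (l3+1)
      = a l1 (l2+1) l3 * b l1 l2 (l3+1) * c (l1+1) l2 l3" for l1 l2 l3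
  proof -
    have "((z (l1+1) l2 l3 - z (l1+1) (l2+1) l3) * (z l1 (l2+1) l3 - z l1 (l2+1) (l3+1))
        * (z l1 l2 (l3+1) - z (l1+1) l2 (l3+1)))
      / ((z (l1+1) (l2+1) l3 - z l1 (l2+1) l3) * (z l1 (l2+1) (l3+1) - z l1 l2 (l3+1))
        * (z (l1+1) l2 (l3+1) - z (l1+1) l2 l3)) = -1"
      using KP unfolding discrete_schwarzian_KP_def by blast
    then show ?thesis
      unfolding divide_eq_minus_1_iff edges by algebra
  qed
  \<comment> \<open>The shift to \<open>l3 + 1\<close> puts the backward-looking condition on the
    same cube as \<open>eqKP\<close>; \<open>eq2\<close> uses \<open>l2 + 1\<close>
    likewise.\<close>
  have eq3: "b (l1+1) l2 (l3+1) * c l1 (l2+1) l3 * a l1 l2 l3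
      = a l1 (l2+1) (l3+1) * b l1 l2 l3 * c (l1+1) l2 l3" for l1 l2 l3
    using cond3 [of l1 l2 "l3 + 1"]
    unfolding divide_eq_minus_1_iff edges add_diff_cancel_right' by algebra
  have eq2: "b (l1+1) l2 l3 * c l1 l2 l3 * a l1 (l2+1) (l3+1)
      = a l1 l2 l3 * b l1 l2 (l3+1) * c (l1+1) (l2+1) l3" for l1 l2 l3
    using cond2 [of l1 "l2 + 1" l3]
    unfolding divide_eq_minus_1_iff edges add_diff_cancel_right' by algebra
  define Q13 where "Q13 l1 l2 = a l1 l2 l3 * a l1 l2 (l3+1) / (c l1 l2 l3 * c (l1+1) l2 l3)" for l1 l2
  define Q23 where "Q23 l1 l2 = b l1 l2 l3 * b l1 l2 (l3+1) / (c l1 l2 l3 * c l1 (l2+1) l3)" for l1 l2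
  have "Q13 l1 (l2+1) = Q13 l1 l2" for l1 l2
  proof -
    \<comment> \<open>Multiply \<open>eqKP\<close> and \<open>eq2\<close> crosswise; the common
      factor of two \<open>b\<close> edges is nonzero and cancels.\<close>
    have "(a l1 (l2+1) l3 * a l1 (l2+1) (l3+1) * (c l1 l2 l3 * c (l1+1) l2 l3)) * (b (l1+1) l2 l3 * b l1 l2 (l3+1))
      = (a l1 l2 l3 * a l1 l2 (l3+1) * (c l1 (l2+1) l3 * c (l1+1) (l2+1) l3)) * (b (l1+1) l2 l3 * b l1 l2 (l3+1))"
      using eqKP [of l1 l2 l3] eq2 [of l1 l2 l3] by algebra
    then show ?thesis
      by (simp add: Q13_def nz frac_eq_eq)
  qed
  then have Q13_const: "Q13 l1 l2 = Q13 l1 0" for l1 l2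
    by (rule int_shift_invariant_const)
  have "Q23 (l1+1) l2 = Q23 l1 l2" for l1 l2
  proof -
    \<comment> \<open>Multiply \<open>eq3\<close> and \<open>eq2\<close> side by side; now two
      \<open>a\<close> edges cancel.\<close>
    have "(b (l1+1) l2 l3 * b (l1+1) l2 (l3+1) * (c l1 l2 l3 * c l1 (l2+1) l3)) * (a l1 l2 l3 * a l1 (l2+1) (l3+1))
      = (b l1 l2 l3 * b l1 l2 (l3+1) * (c (l1+1) l2 l3 * c (l1+1) (l2+1) l3)) * (a l1 l2 l3 * a l1 (l2+1) (l3+1))"
      using eq3 [of l1 l2 l3] eq2 [of l1 l2 l3] by algebra
    then show ?thesis
      by (simp add: Q23_def nz frac_eq_eq)
  qed
  then have Q23_const: "Q23 l1 l2 = Q23 0 l2" for l1 l2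
    by (rule int_shift_invariant_const [where f = "\<lambda>l1. Q23 l1 l2" for l2])
  have Q12: "a l1 l2 l3 * a l1 (l2+1) l3 / (b (l1+1) l2 l3 * b l1 l2 l3) = Q13 l1 l2 / Q23 l1 l2" for l1 l2
    using eqKP [of l1 l2 l3] by (simp add: Q13_def Q23_def nz divide_simps mult_ac)
  \<comment> \<open>By the two invariances, freezing the idle argument at \<open>0\<close> gives
    witnesses of one variable each.\<close>
  have "discrete_schwarzian_KdV (\<lambda>l1. Q13 l1 0) (Q23 0) (\<lambda>l1 l2. z l1 l2 l3)"
    unfolding discrete_schwarzian_KdV_def
  proof (intro allI conjI)
    fix l1 l2
    \<comment> \<open>Numerator and denominator each contain one reversed edge, so the signs cancel
      in the quotient.\<close>
    have num: "(z l1 l2 l3 - z (l1+1) l2 l3) * (z (l1+1) (l2+1) l3 - z l1 (l2+1) l3)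
        = - (a l1 l2 l3 * a l1 (l2+1) l3)"
      by (simp add: a_def algebra_simps)
    have den: "(z (l1+1) l2 l3 - z (l1+1) (l2+1) l3) * (z l1 (l2+1) l3 - z l1 l2 l3)
        = - (b (l1+1) l2 l3 * b l1 l2 l3)"
      by (simp add: b_def algebra_simps)
    show "(z (l1+1) l2 l3 - z (l1+1) (l2+1) l3) * (z l1 (l2+1) l3 - z l1 l2 l3) \<noteq> 0"
      by (simp add: den nz)
    show "Q23 0 l2 \<noteq> 0"
      by (simp add: Q23_def nz)
    show "(z l1 l2 l3 - z (l1+1) l2 l3) * (z (l1+1) (l2+1) l3 - z l1 (l2+1) l3)
        / ((z (l1+1) l2 l3 - z (l1+1) (l2+1) l3) * (z l1 (l2+1) l3 - z l1 l2 l3))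
        = Q13 l1 0 / Q23 0 l2"
      unfolding num den
      using Q12 [of l1 l2] by (simp add: Q13_const [of l1 l2] Q23_const [of l1 l2])
  qed
  then show "\<exists>lam mu. discrete_schwarzian_KdV lam mu (\<lambda>l1 l2. z l1 l2 l3)"
    by blast
qed

end
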